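(* Let $A$ be a skew left brace. The following statements are equivalent: (1) $A^{[\alpha]}=0$ for some positive integer $\alpha$. (2) $A^{(\beta)}=0$ and $A^{\gamma}=0$ for some positive integers $\beta,\gamma$.
   Context: A skew left brace is a triple $(A,+,\circ)$ where $(A,+)$ and $(A,\circ)$ are (not necessarily abelian) groups such that $a\circ(b+c)=a\circ b-a+a\circ c$ for all $a,b,c\in A$. The two groups share the same neutral element $0$. For $a,b\in A$ put $a*b=-a+a\circ b-b$. For subsets $X,Y\subseteq A$, $X*Y$ denotes the subgroup of $(A,+)$ generated by all $x*y$ with $x\in X$, $y\in Y$. Define three series, for $n\ge 1$: the right series $A^{(1)}=A$, $A^{(n+1)}=A^{(n)}*A$; the left series $A^{1}=A$, $A^{n+1}=A*A^{n}$; and $A^{[1]}=A$, with $A^{[n+1]}$ the subgroup of $(A,+)$ generated by $\bigcup_{i=1}^{n} A^{[i]}*A^{[n+1-i]}$. *)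

theory Defs
  imports "HOL-Algebra.Generated_Groups" "HOL-Algebra.Ring"
begin

text \<open>
  The \<^type>\<open>ring_scheme\<close> record is reused only for its signature: \<open>\<oplus>\<close> is the additive operation
  of the brace, \<open>\<otimes>\<close> is its circle operation, and neither group is assumed abelian.  That the two
  neutral elements coincide is a consequence of the axioms (see \<open>one_eq_zero\<close> below).
\<close>

locale skew_left_brace =
  fixes A :: "('a, 'b) ring_scheme" (structure)
  assumes add_group: "group (add_monoid A)"
    and circ_group: "group A"
    and brace_distrib:
      "\<lbrakk>a \<in> carrier A; b \<in> carrier A; c \<in> carrier A\<rbrakk>
        \<Longrightarrow> a \<otimes> (b \<oplus> c) = ((a \<otimes> b) \<ominus> a) \<oplus> (a \<otimes> c)"

definition brace_star :: "('a, 'b) ring_scheme \<Rightarrow> 'a \<Rightarrow> 'a \<Rightarrow> 'a" where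
  "brace_star A a b = ((\<ominus>\<^bsub>A\<^esub> a) \<oplus>\<^bsub>A\<^esub> (a \<otimes>\<^bsub>A\<^esub> b)) \<ominus>\<^bsub>A\<^esub> b"

definition star_subgroup :: "('a, 'b) ring_scheme \<Rightarrow> 'a set \<Rightarrow> 'a set \<Rightarrow> 'a set" where
  "star_subgroup A X Y =
     generate (add_monoid A) {brace_star A x y | x y. x \<in> X \<and> y \<in> Y}"

text \<open>All three series start at index 1; their value at index 0 is a dummy.\<close>

fun right_series :: "('a, 'b) ring_scheme \<Rightarrow> nat \<Rightarrow> 'a set" where
  "right_series A 0 = carrier A"
| "right_series A (Suc 0) = carrier A"
| "right_series A (Suc (Suc n)) = star_subgroup A (right_series A (Suc n)) (carrier A)"

fun left_series :: "('a, 'b) ring_scheme \<Rightarrow> nat \<Rightarrow> 'a set" where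
  "left_series A 0 = carrier A"
| "left_series A (Suc 0) = carrier A"
| "left_series A (Suc (Suc n)) = star_subgroup A (carrier A) (left_series A (Suc n))"

function bracket_series :: "('a, 'b) ring_scheme \<Rightarrow> nat \<Rightarrow> 'a set" where
  "bracket_series A 0 = carrier A"
| "bracket_series A (Suc 0) = carrier A"
| "bracket_series A (Suc (Suc n)) =
     generate (add_monoid A)
       (\<Union>i\<in>{1..Suc n}. star_subgroup A (bracket_series A i) (bracket_series A (Suc (Suc n) - i)))"
  by pat_completeness auto
termination
  by (relation "measure snd") auto

lemma (in skew_left_brace) one_eq_zero: "\<one> = \<zero>"
proof -
  interpret C: group A by (rule circ_group)
  interpret P: group "add_monoid A" by (rule add_group)
  have z: "\<zero> \<in> carrier A" using P.one_closed by simp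
  have "\<one> \<otimes> (\<zero> \<oplus> \<zero>) = ((\<one> \<otimes> \<zero>) \<ominus> \<one>) \<oplus> (\<one> \<otimes> \<zero>)"
    using z by (intro brace_distrib) auto
  moreover have "\<zero> \<oplus> \<zero> = \<zero>" using P.l_one[of \<zero>] z by simp
  ultimately have "\<zero> = (\<zero> \<ominus> \<one>) \<oplus> \<zero>" using z by simp
  moreover have inv: "\<ominus> \<one> \<in> carrier A" using P.inv_closed[of \<one>] by (simp add: a_inv_def)
  ultimately have "\<ominus> \<one> = \<zero>"
    using P.l_one[of "\<ominus> \<one>"] P.r_one[of "\<ominus> \<one>"] by (simp add: a_minus_def)
  then show ?thesis
    using P.r_inv[of \<one>] P.r_one[of \<one>] by (simp add: a_inv_def)
qed

end

theory Submission
  imports Defs "HOL-Algebra.Zassenhaus"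
begin

text \<open>
  Every term of the right series is an ideal.  Suppose \<open>A\<^bsup>[s]\<^esup> \<subseteq> A\<^bsup>(k)\<^esup>\<close> and work modulo
  the ideal \<open>I = A\<^bsup>(k+1)\<^esup>\<close>.  Among the products \<open>A\<^bsup>[i]\<^esup> * A\<^bsup>[N-i]\<^esup>\<close> generating \<open>A\<^bsup>[N]\<^esup>\<close>,
  those with \<open>i \<ge> s\<close> vanish, and the others lie in \<open>A * A\<^bsup>[N-s]\<^esup>\<close>.  So lowering the index by \<open>s\<close>
  gains one step of the left series, whose nilpotency gives \<open>A\<^bsup>[N]\<^esup> \<subseteq> I\<close> for large \<open>N\<close>.
  The converse holds because the bracket series contains the other two.
\<close>

context skew_left_brace
begin

section \<open>The two group structures, the lambda action and the star operation\<close>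

sublocale add: group "add_monoid A"
  rewrites "carrier (add_monoid A) = carrier A"
    and "mult (add_monoid A) = add A"
    and "one (add_monoid A) = zero A"
    and "m_inv (add_monoid A) = a_inv A"
  by (rule add_group) (auto simp: a_inv_def)

sublocale circ: group A
  by (rule circ_group)

lemma add_cancel [simp]:
  assumes "x \<in> carrier A" "y \<in> carrier A"
  shows "x \<oplus> (\<ominus> x \<oplus> y) = y" "\<ominus> x \<oplus> (x \<oplus> y) = y"
  using assms by (simp_all flip: add.m_assoc)

text \<open>The usual lambda map of a skew brace, that is, the action of the circle group on the
  additive group by automorphisms.\<close>

definition lam :: "'a \<Rightarrow> 'a \<Rightarrow> 'a" where
  "lam a b = \<ominus> a \<oplus> a \<otimes> b"

abbreviation star :: "'a \<Rightarrow> 'a \<Rightarrow> 'a"  (infixl "\<star>" 70) where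
  "a \<star> b \<equiv> brace_star A a b"

lemma lam_closed [simp]: "\<lbrakk>a \<in> carrier A; b \<in> carrier A\<rbrakk> \<Longrightarrow> lam a b \<in> carrier A"
  by (simp add: lam_def)

lemma circ_eq: "\<lbrakk>a \<in> carrier A; b \<in> carrier A\<rbrakk> \<Longrightarrow> a \<otimes> b = a \<oplus> lam a b"
  by (simp add: lam_def)

lemma star_eq: "a \<star> b = lam a b \<oplus> \<ominus> b"
  by (simp add: brace_star_def lam_def a_minus_def)

lemma star_closed [simp]: "\<lbrakk>a \<in> carrier A; b \<in> carrier A\<rbrakk> \<Longrightarrow> a \<star> b \<in> carrier A"
  by (simp add: star_eq)

lemma lam_add:
  assumes "a \<in> carrier A" "b \<in> carrier A" "c \<in> carrier A"
  shows "lam a (b \<oplus> c) = lam a b \<oplus> lam a c"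
  using assms by (simp add: lam_def brace_distrib a_minus_def add.m_assoc)

lemma lam_hom: "a \<in> carrier A \<Longrightarrow> lam a \<in> hom (add_monoid A) (add_monoid A)"
  by (simp add: hom_def lam_add)

lemma lam_group_hom: "a \<in> carrier A \<Longrightarrow> group_hom (add_monoid A) (add_monoid A) (lam a)"
  by (simp add: group_hom_def group_hom_axioms_def lam_hom add_group)

lemma lam_minus:
  assumes "a \<in> carrier A" "b \<in> carrier A"
  shows "lam a (\<ominus> b) = \<ominus> lam a b"
  using group_hom.hom_inv[OF lam_group_hom] assms by (simp add: a_inv_def)

text \<open>Expanding both bracketings of \<open>a \<otimes> b \<otimes> c\<close> by
  \<open>circ_eq\<close> and \<open>lam_add\<close> leaves the common prefix
  \<open>a \<oplus> lam a b\<close>, which cancels.\<close>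

lemma lam_circ:
  assumes "a \<in> carrier A" "b \<in> carrier A" "c \<in> carrier A"
  shows "lam (a \<otimes> b) c = lam a (lam b c)"
proof -
  have "a \<oplus> (lam a b \<oplus> lam a (lam b c)) = a \<otimes> (b \<otimes> c)"
    using assms by (simp add: circ_eq lam_add)
  also have "\<dots> = (a \<otimes> b) \<oplus> lam (a \<otimes> b) c"
    using assms by (simp only: circ.m_assoc[symmetric] circ_eq[of "a \<otimes> b"] circ.m_closed)
  also have "\<dots> = a \<oplus> (lam a b \<oplus> lam (a \<otimes> b) c)"
    using assms by (simp only: circ_eq[of a b] add.m_assoc lam_closed circ.m_closed add.m_closed)
  finally show ?thesis using assms by simp
qed

text \<open>A commutator identity: in the semidirect product given by \<open>lam\<close>,
  \<open>a \<star> b\<close> is the commutator of \<open>a\<close> and \<open>b\<close>. The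
  conjugation by \<open>b\<close> remains because addition need not commute.\<close>

lemma star_add:
  assumes "a \<in> carrier A" "b \<in> carrier A" "c \<in> carrier A"
  shows "a \<star> (b \<oplus> c) = a \<star> b \<oplus> b \<oplus> a \<star> c \<oplus> \<ominus> b"
  using assms by (simp add: star_eq lam_add add.m_assoc add.inv_mult_group)

text \<open>As \<open>lam\<close> is an action, \<open>lam c\<close> intertwines
  \<open>lam a\<close> with the lambda map of the circle conjugate of \<open>a\<close>. Closure of
  \<open>I\<close> under circle conjugation thus makes the star subgroup of \<open>I\<close> and the
  carrier lambda-invariant.\<close>

lemma lam_star:
  assumes "a \<in> carrier A" "b \<in> carrier A" "c \<in> carrier A"
  shows "lam c (a \<star> b) = (c \<otimes> a \<otimes> inv c) \<star> lam c b"
proof -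
  have "lam (c \<otimes> a \<otimes> inv c) (lam c b) = lam (c \<otimes> a \<otimes> inv c \<otimes> c) b"
    using assms by (simp only: lam_circ circ.m_closed circ.inv_closed)
  also have "c \<otimes> a \<otimes> inv c \<otimes> c = c \<otimes> a"
    using assms by (simp add: circ.m_assoc)
  finally show ?thesis
    using assms by (simp add: star_eq lam_add lam_minus lam_circ)
qed

section \<open>Additive subgroups generated by stars\<close>

lemma star_subgroup_subgroup:
  assumes "X \<subseteq> carrier A" "Y \<subseteq> carrier A"
  shows "subgroup (star_subgroup A X Y) (add_monoid A)"
  unfolding star_subgroup_def by (rule add.generate_is_subgroup) (use assms in \<open>auto intro!: star_closed\<close>)

lemma star_in_star_subgroup: "x \<in> X \<Longrightarrow> y \<in> Y \<Longrightarrow> x \<star> y \<in> star_subgroup A X Y"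
  unfolding star_subgroup_def by (rule generate.incl) auto

lemma star_subgroup_subset:
  assumes "subgroup H (add_monoid A)" "\<And>x y. x \<in> X \<Longrightarrow> y \<in> Y \<Longrightarrow> x \<star> y \<in> H"
  shows "star_subgroup A X Y \<subseteq> H"
  unfolding star_subgroup_def by (rule add.generate_subgroup_incl) (use assms in auto)

lemma star_subgroup_mono:
  "X \<subseteq> X' \<Longrightarrow> Y \<subseteq> Y' \<Longrightarrow> star_subgroup A X Y \<subseteq> star_subgroup A X' Y'"
  unfolding star_subgroup_def by (rule add.mono_generate) auto

section \<open>Ideals, and the terms of the right series as ideals\<close>

text \<open>The standard ideals of skew braces. That \<open>I\<close> is also a circle subgroup
  follows from \<open>x \<otimes> y = x \<oplus> lam x y\<close> and
  \<open>inv x = \<ominus> lam (inv x) x\<close>.\<close>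

definition brace_ideal :: "'a set \<Rightarrow> bool" where
  "brace_ideal I \<longleftrightarrow> I \<lhd> add_monoid A
     \<and> (\<forall>c\<in>carrier A. \<forall>x\<in>I. lam c x \<in> I)
     \<and> (\<forall>c\<in>carrier A. \<forall>x\<in>I. c \<otimes> x \<otimes> inv c \<in> I)"

lemma brace_ideal_carrier: "brace_ideal (carrier A)"
proof -
  have "carrier A \<lhd> add_monoid A"
    using add.normal_inv_iff add.subgroup_self by auto
  then show ?thesis by (simp add: brace_ideal_def)
qed

context
  fixes I
  assumes ideal: "brace_ideal I"
begin

lemma ideal_subgroup: "subgroup I (add_monoid A)"
  using ideal by (simp add: brace_ideal_def normal_imp_subgroup)

lemma ideal_subset: "I \<subseteq> carrier A"
  using subgroup.subset[OF ideal_subgroup] by simp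

lemma ideal_conj_add: "c \<in> carrier A \<Longrightarrow> x \<in> I \<Longrightarrow> c \<oplus> x \<oplus> \<ominus> c \<in> I"
  using ideal add.normal_inv_iff by (auto simp: brace_ideal_def)

lemma ideal_lam: "c \<in> carrier A \<Longrightarrow> x \<in> I \<Longrightarrow> lam c x \<in> I"
  using ideal by (simp add: brace_ideal_def)

lemma ideal_conj_circ: "c \<in> carrier A \<Longrightarrow> x \<in> I \<Longrightarrow> c \<otimes> x \<otimes> inv c \<in> I"
  using ideal by (simp add: brace_ideal_def)

lemma ideal_add: "x \<in> I \<Longrightarrow> y \<in> I \<Longrightarrow> x \<oplus> y \<in> I"
  using subgroup.m_closed[OF ideal_subgroup] by simp

lemma ideal_minus: "x \<in> I \<Longrightarrow> \<ominus> x \<in> I"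
  using subgroup.m_inv_closed[OF ideal_subgroup] by (simp add: a_inv_def)

lemma star_ideal: "a \<in> carrier A \<Longrightarrow> x \<in> I \<Longrightarrow> a \<star> x \<in> I"
  by (simp add: star_eq ideal_add ideal_lam ideal_minus)

text \<open>Replacing \<open>x\<close> by its circle conjugate \<open>y\<close> moves the ideal
  element to the right of \<open>b\<close>. Then \<open>x \<star> b\<close> is
  \<open>\<ominus> x\<close> plus an additive conjugate of \<open>lam b y\<close>.\<close>

lemma ideal_star:
  assumes "x \<in> I" "b \<in> carrier A"
  shows "x \<star> b \<in> I"
proof -
  have x: "x \<in> carrier A" using assms ideal_subset by auto
  define y where "y = inv b \<otimes> x \<otimes> b"
  have y: "y \<in> I" "y \<in> carrier A"
    using ideal_conj_circ[of "inv b" x] assms x by (auto simp: y_def)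
  have "x \<otimes> b = b \<otimes> y"
    using assms x by (simp add: y_def flip: circ.m_assoc)
  also have "\<dots> = b \<oplus> lam b y"
    using assms y by (simp only: circ_eq)
  finally have "x \<star> b = \<ominus> x \<oplus> (b \<oplus> lam b y \<oplus> \<ominus> b)"
    using assms x y by (simp add: star_eq lam_def[of x] add.m_assoc)
  then show ?thesis
    using assms y by (simp add: ideal_add ideal_minus ideal_conj_add ideal_lam)
qed

text \<open>Additive conjugation and \<open>lam c\<close> are additive endomorphisms, so they need
  checking on generators only; circle conjugation is then expressed through these two.\<close>

lemma brace_ideal_star_subgroup: "brace_ideal (star_subgroup A I (carrier A))"
proof -
  let ?J = "star_subgroup A I (carrier A)"
  have sub: "subgroup ?J (add_monoid A)"
    using ideal_subset by (intro star_subgroup_subgroup) auto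
  have JI: "?J \<subseteq> I"
    by (rule star_subgroup_subset[OF ideal_subgroup ideal_star])
  have gen: "f x \<in> ?J"
    if f: "group_hom (add_monoid A) (add_monoid A) f"
      and star: "\<And>x y. x \<in> I \<Longrightarrow> y \<in> carrier A \<Longrightarrow> f (x \<star> y) \<in> ?J"
      and x: "x \<in> ?J" for f x
  proof -
    let ?S = "{x \<star> y | x y. x \<in> I \<and> y \<in> carrier A}"
    have "?S \<subseteq> carrier (add_monoid A)" using ideal_subset by auto
    from group_hom.generate_img[OF f this]
    have "f ` ?J = generate (add_monoid A) (f ` ?S)" by (simp add: star_subgroup_def)
    also have "\<dots> \<subseteq> ?J" by (rule add.generate_subgroup_incl[OF _ sub]) (use star in auto)
    finally show ?thesis using x by auto
  qed
  have add: "c \<oplus> x \<oplus> \<ominus> c \<in> ?J" if "c \<in> carrier A" "x \<in> ?J" for c x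
  proof -
    have "group_hom (add_monoid A) (add_monoid A) (\<lambda>x. c \<oplus> x \<oplus> \<ominus> c)"
      using that
      by (simp add: group_hom_def group_hom_axioms_def hom_def add_group add.m_assoc)
    moreover have "c \<oplus> a \<star> b \<oplus> \<ominus> c \<in> ?J" if ab: "a \<in> I" "b \<in> carrier A" for a b
    proof -
      \<comment> \<open>This is \<open>star_add\<close> for \<open>a \<star> (c \<oplus> b)\<close>,
        solved for the conjugate; both stars on the right are generators of
        \<open>?J\<close>.\<close>
      have "c \<oplus> a \<star> b \<oplus> \<ominus> c = \<ominus> (a \<star> c) \<oplus> a \<star> (c \<oplus> b)"
        using ab \<open>c \<in> carrier A\<close> ideal_subset by (simp add: star_add add.m_assoc subset_iff)
      then show ?thesis
        using ab \<open>c \<in> carrier A\<close> subgroup.m_closed[OF sub] subgroup.m_inv_closed[OF sub]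
        by (simp add: a_inv_def star_in_star_subgroup)
    qed
    ultimately show ?thesis using gen that by blast
  qed
  have lam: "lam c x \<in> ?J" if "c \<in> carrier A" "x \<in> ?J" for c x
  proof -
    have "lam c (a \<star> b) \<in> ?J" if "a \<in> I" "b \<in> carrier A" for a b
      using that \<open>c \<in> carrier A\<close> ideal_subset
      by (auto simp: lam_star subset_iff intro!: star_in_star_subgroup ideal_conj_circ)
    then show ?thesis using gen lam_group_hom that by blast
  qed
  have "c \<otimes> x \<otimes> inv c \<in> ?J" if c: "c \<in> carrier A" and x: "x \<in> ?J" for c x
  proof -
    have xA: "x \<in> carrier A" using x JI ideal_subset by auto
    \<comment> \<open>The aim is to write the circle conjugate as the additive conjugate by
      \<open>c\<close> of \<open>lam c (x \<oplus> x \<star> inv c)\<close>.\<close>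
    have "c \<otimes> x \<otimes> inv c = c \<otimes> (x \<oplus> (x \<star> inv c \<oplus> inv c))"
      using c xA by (simp add: star_eq circ.m_assoc add.m_assoc circ_eq[of x])
    also have "\<dots> = c \<oplus> lam c (x \<oplus> x \<star> inv c) \<oplus> lam c (inv c)"
      using c xA by (simp add: circ_eq[of c] lam_add add.m_assoc)
    also have "lam c (inv c) = \<ominus> c"
      using c by (simp add: lam_def one_eq_zero)
    finally have "c \<otimes> x \<otimes> inv c = c \<oplus> lam c (x \<oplus> x \<star> inv c) \<oplus> \<ominus> c" .
    \<comment> \<open>Since \<open>?J\<close> lies in \<open>I\<close>, \<open>x\<close> is in
      \<open>I\<close> and \<open>x \<star> inv c\<close> is itself a generator of
      \<open>?J\<close>.\<close>
    moreover have "x \<oplus> x \<star> inv c \<in> ?J"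
      using c x JI subgroup.m_closed[OF sub] star_in_star_subgroup by auto
    ultimately show ?thesis using c add lam by simp
  qed
  then show ?thesis
    using add lam sub add.normal_inv_iff by (auto simp: brace_ideal_def)
qed

end

lemma right_series_Suc:
  "n > 0 \<Longrightarrow> right_series A (Suc n) = star_subgroup A (right_series A n) (carrier A)"
  by (cases n) auto

lemma brace_ideal_right_series: "brace_ideal (right_series A n)"
proof (induction n)
  case (Suc n)
  then show ?case
    by (cases "n = 0") (simp_all add: right_series_Suc brace_ideal_carrier brace_ideal_star_subgroup)
qed (simp add: brace_ideal_carrier)

section \<open>Left and bracket series: recursion, subgroups and inclusions\<close>

lemma left_series_Suc:
  "n > 0 \<Longrightarrow> left_series A (Suc n) = star_subgroup A (carrier A) (left_series A n)"
  by (cases n) auto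

lemma bracket_series_gt_1:
  "n > 1 \<Longrightarrow> bracket_series A n = generate (add_monoid A)
     (\<Union>i\<in>{1..<n}. star_subgroup A (bracket_series A i) (bracket_series A (n - i)))"
  by (cases "(A, n)" rule: bracket_series.cases) (auto simp: atLeastLessThanSuc_atLeastAtMost)

lemma left_series_subgroup: "subgroup (left_series A n) (add_monoid A)"
proof (induction n)
  case (Suc n)
  then show ?case
    using add.subgroup_self subgroup.subset[OF Suc]
    by (cases "n = 0") (auto simp: left_series_Suc intro!: star_subgroup_subgroup)
qed (use add.subgroup_self in simp)

lemma bracket_series_subgroup: "subgroup (bracket_series A n) (add_monoid A)"
proof (induction n rule: less_induct)
  case (less n)
  show ?case
  proof (cases "n > 1")
    case True
    have "bracket_series A i \<subseteq> carrier A" if "i < n" for i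
      using subgroup.subset[OF less[OF that]] by simp
    then have "star_subgroup A (bracket_series A i) (bracket_series A (n - i)) \<subseteq> carrier A"
      if "i \<in> {1..<n}" for i
      using that subgroup.subset[OF star_subgroup_subgroup, of "bracket_series A i" "bracket_series A (n - i)"]
      by simp
    then have "(\<Union>i\<in>{1..<n}. star_subgroup A (bracket_series A i) (bracket_series A (n - i)))
        \<subseteq> carrier A"
      by (rule UN_least)
    then show ?thesis
      unfolding bracket_series_gt_1[OF True] by (rule add.generate_is_subgroup)
  next
    case False
    then have "n = 0 \<or> n = Suc 0" by auto
    then show ?thesis using add.subgroup_self by auto
  qed
qed

lemma star_subgroup_bracket_series:
  assumes "0 < i" "i < n"
  shows "star_subgroup A (bracket_series A i) (bracket_series A (n - i)) \<subseteq> bracket_series A n"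
proof -
  have "n > 1" using assms by simp
  show ?thesis
    unfolding bracket_series_gt_1[OF \<open>n > 1\<close>]
    by (intro subsetI generate.incl UN_I[of i]) (use assms in auto)
qed

text \<open>Collapses the two nested layers of generation in the recursion to a check on single
  stars.\<close>

lemma bracket_series_subset:
  assumes "n > 1" "subgroup H (add_monoid A)"
    and "\<And>i x y. \<lbrakk>0 < i; i < n; x \<in> bracket_series A i; y \<in> bracket_series A (n - i)\<rbrakk>
           \<Longrightarrow> x \<star> y \<in> H"
  shows "bracket_series A n \<subseteq> H"
  unfolding bracket_series_gt_1[OF assms(1)]
proof (intro add.generate_subgroup_incl UN_least star_subgroup_subset assms(2))
  fix i x y
  assume "i \<in> {1..<n}" "x \<in> bracket_series A i" "y \<in> bracket_series A (n - i)"
  then show "x \<star> y \<in> H" by (intro assms(3)[of i]) auto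
qed

lemma bracket_series_Suc: "bracket_series A (Suc n) \<subseteq> bracket_series A n"
proof (induction n rule: less_induct)
  case (less n)
  show ?case
  proof (cases "n > 1")
    case True
    show ?thesis
    proof (rule bracket_series_subset[OF _ bracket_series_subgroup])
      fix i x y
      assume i: "0 < i" "i < Suc n"
        and xy: "x \<in> bracket_series A i" "y \<in> bracket_series A (Suc n - i)"
      \<comment> \<open>The induction hypothesis lowers one of the two indices by 1: the first if it
        stays positive, otherwise the second, which is then \<open>n > 1\<close>.\<close>
      show "x \<star> y \<in> bracket_series A n"
      proof (cases "i = 1")
        case True
        have "y \<in> bracket_series A (n - 1)"
          using xy less[of "n - 1"] \<open>n > 1\<close> True by auto
        then show ?thesis
          using star_subgroup_bracket_series[of i n] star_in_star_subgroup[OF xy(1)] \<open>n > 1\<close> True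
          by auto
      next
        case False
        have "x \<in> bracket_series A (i - 1)" "Suc n - i = n - (i - 1)"
          using xy less[of "i - 1"] i False by (auto simp: less_diff_conv2)
        then show ?thesis
          using star_subgroup_bracket_series[of "i - 1" n] star_in_star_subgroup xy i False
          by fastforce
      qed
    qed (use True in simp)
  next
    case False
    then have "n = 0 \<or> n = Suc 0" by auto
    then have "bracket_series A n = carrier A" by auto
    then show ?thesis
      using subgroup.subset[OF bracket_series_subgroup] by simp
  qed
qed

lemma bracket_series_antimono: "m \<le> n \<Longrightarrow> bracket_series A n \<subseteq> bracket_series A m"
  by (rule lift_Suc_antimono_le[of "bracket_series A"]) (rule bracket_series_Suc)

text \<open>The left recursion is the contribution \<open>i = 1\<close> to the bracket recursion, up
  to the induction hypothesis.\<close>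

lemma left_series_subset_bracket_series: "left_series A n \<subseteq> bracket_series A n"
proof (induction n)
  case (Suc n)
  show ?case
  proof (cases "n = 0")
    case False
    then show ?thesis
      using star_subgroup_mono[OF subset_refl Suc, of "carrier A"]
        star_subgroup_bracket_series[of 1 "Suc n"] by (simp add: left_series_Suc)
  qed simp
qed simp

text \<open>Here the last index is used: the second factor is then the bracket term of index 1, the
  whole carrier.\<close>

lemma right_series_subset_bracket_series: "right_series A n \<subseteq> bracket_series A n"
proof (induction n)
  case (Suc n)
  show ?case
  proof (cases "n = 0")
    case False
    then show ?thesis
      using star_subgroup_mono[OF Suc subset_refl, of "carrier A"]
        star_subgroup_bracket_series[of n "Suc n"] by (simp add: right_series_Suc)
  qed simp
qed simp

section \<open>Bracket terms modulo a term of the right series\<close>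

text \<open>Adding the ideal to a left term expresses inclusion modulo the ideal without forming a
  quotient brace. The index \<open>Suc (j * s)\<close> starts at 1, where the bracket and left terms
  are both the carrier.\<close>

lemma bracket_series_subset_left_add_right:
  assumes "k > 0" "s > 0" "bracket_series A s \<subseteq> right_series A k"
  shows "bracket_series A (Suc (j * s))
    \<subseteq> right_series A (Suc k) <#>\<^bsub>add_monoid A\<^esub> left_series A (Suc j)"
proof -
  let ?I = "right_series A (Suc k)"
  let ?S = "\<lambda>j. ?I <#>\<^bsub>add_monoid A\<^esub> left_series A (Suc j)"
  note I = brace_ideal_right_series[of "Suc k"]
  \<comment> \<open>A normal subgroup plus a subgroup is a subgroup; additive normality of
    \<open>?I\<close> enters here.\<close>
  have S: "subgroup (?S j) (add_monoid A)" for j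
    using I add.mult_norm_subgroup[OF _ left_series_subgroup] by (simp add: brace_ideal_def)
  have I0: "\<zero> \<in> ?I" and L0: "\<zero> \<in> left_series A j" for j
    using subgroup.one_closed[OF ideal_subgroup[OF I]] subgroup.one_closed[OF left_series_subgroup]
    by auto
  have L_carrier: "left_series A j \<subseteq> carrier A" for j
    using subgroup.subset[OF left_series_subgroup] by simp
  have IS: "?I \<subseteq> ?S j" for j
    using L0 ideal_subset[OF I] unfolding set_mult_def by force
  have LS: "left_series A (Suc j) \<subseteq> ?S j" for j
    using I0 L_carrier unfolding set_mult_def by force
  show ?thesis
  proof (induction j)
    case 0
    then show ?case using LS[of 0] by simp
  next
    case (Suc j)
    show ?case
    proof (rule bracket_series_subset[OF _ S])
      fix i x y
      assume i: "0 < i" "i < Suc (Suc j * s)" and x: "x \<in> bracket_series A i"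
        and y: "y \<in> bracket_series A (Suc (Suc j * s) - i)"
      have xA: "x \<in> carrier A" and yA: "y \<in> carrier A"
        using x y subgroup.subset[OF bracket_series_subgroup] by auto
      show "x \<star> y \<in> ?S (Suc j)"
      proof (cases "i \<ge> s")
        case True
        \<comment> \<open>A large first index puts \<open>x\<close> in term \<open>k\<close> of the
          right series, so its star with anything falls into \<open>?I\<close>.\<close>
        then have "x \<in> right_series A k"
          using x assms(3) bracket_series_antimono by blast
        then have "x \<star> y \<in> ?I"
          using yA star_in_star_subgroup by (simp add: right_series_Suc[OF assms(1)])
        then show ?thesis using IS by blast
      next
        case False
        \<comment> \<open>A small first index leaves the second large enough for the induction
          hypothesis to split \<open>y\<close>.\<close>
        then have "Suc (j * s) \<le> Suc (Suc j * s) - i" by simp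
        then have "y \<in> bracket_series A (Suc (j * s))"
          using y bracket_series_antimono by blast
        then obtain u v where u: "u \<in> ?I" and v: "v \<in> left_series A (Suc j)" and y_eq: "y = u \<oplus> v"
          using Suc.IH by (auto simp: set_mult_def)
        have "x \<star> v \<in> left_series A (Suc (Suc j))"
          using xA v star_in_star_subgroup by simp
        then have "x \<star> u \<in> ?S (Suc j)" "u \<in> ?S (Suc j)" "\<ominus> u \<in> ?S (Suc j)" "x \<star> v \<in> ?S (Suc j)"
          using IS LS star_ideal[OF I xA] ideal_minus[OF I] u by blast+
        \<comment> \<open>All terms with \<open>u\<close> stay in the ideal, while
          \<open>x \<star> v\<close> has moved one step down the left series.\<close>
        moreover have "x \<star> y = x \<star> u \<oplus> u \<oplus> x \<star> v \<oplus> \<ominus> u"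
          unfolding y_eq using xA u v L_carrier ideal_subset[OF I] by (intro star_add) auto
        ultimately show ?thesis
          using subgroup.m_closed[OF S[of "Suc j"]] by simp
      qed
    qed (use assms in simp)
  qed
qed

text \<open>Each step down the right series turns a bracket index \<open>s\<close> that works for
  \<open>k\<close> into \<open>Suc ((\<gamma> - 1) * s)\<close> for \<open>Suc k\<close>.\<close>

lemma bracket_series_subset_right_series:
  assumes "\<gamma> > 0" "left_series A \<gamma> = {\<zero>}" "k > 0"
  shows "\<exists>n>0. bracket_series A n \<subseteq> right_series A k"
  using assms(3)
proof (induction k rule: nat_induct_non_zero)
  case (Suc k)
  then obtain s where "s > 0" "bracket_series A s \<subseteq> right_series A k" by auto
  \<comment> \<open>With \<open>j = \<gamma> - 1\<close> the left summand has index
    \<open>\<gamma>\<close>, so it is zero and the sum is just the ideal.\<close>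
  from bracket_series_subset_left_add_right[OF Suc(1) this, of "\<gamma> - 1"]
  have "bracket_series A (Suc ((\<gamma> - 1) * s)) \<subseteq> right_series A (Suc k)"
    using assms(1,2) ideal_subset[OF brace_ideal_right_series[of "Suc k"]]
    by (auto simp: set_mult_def subset_iff)
  then show ?case by blast
qed auto

end

theorem theorem2p30:
  fixes A :: "('a, 'b) ring_scheme"
  assumes "skew_left_brace A"
  shows "(\<exists>\<alpha>>0. bracket_series A \<alpha> = {\<zero>\<^bsub>A\<^esub>}) \<longleftrightarrow>
         (\<exists>\<beta>>0. \<exists>\<gamma>>0. right_series A \<beta> = {\<zero>\<^bsub>A\<^esub>} \<and> left_series A \<gamma> = {\<zero>\<^bsub>A\<^esub>})"
proof -
  interpret skew_left_brace A by (rule assms)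
  have zero: "\<zero>\<^bsub>A\<^esub> \<in> left_series A n" "\<zero>\<^bsub>A\<^esub> \<in> right_series A n" "\<zero>\<^bsub>A\<^esub> \<in> bracket_series A n" for n
    using subgroup.one_closed[OF left_series_subgroup] subgroup.one_closed[OF bracket_series_subgroup]
      subgroup.one_closed[OF ideal_subgroup[OF brace_ideal_right_series]] by auto
  show ?thesis
  proof
    assume "\<exists>\<alpha>>0. bracket_series A \<alpha> = {\<zero>\<^bsub>A\<^esub>}"
    then obtain \<alpha> where "\<alpha> > 0" "bracket_series A \<alpha> = {\<zero>\<^bsub>A\<^esub>}" by auto
    then have "right_series A \<alpha> = {\<zero>\<^bsub>A\<^esub>}" "left_series A \<alpha> = {\<zero>\<^bsub>A\<^esub>}"
      using left_series_subset_bracket_series right_series_subset_bracket_series zero by blast+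
    then show "\<exists>\<beta>>0. \<exists>\<gamma>>0. right_series A \<beta> = {\<zero>\<^bsub>A\<^esub>} \<and> left_series A \<gamma> = {\<zero>\<^bsub>A\<^esub>}"
      using \<open>\<alpha> > 0\<close> by blast
  next
    assume "\<exists>\<beta>>0. \<exists>\<gamma>>0. right_series A \<beta> = {\<zero>\<^bsub>A\<^esub>} \<and> left_series A \<gamma> = {\<zero>\<^bsub>A\<^esub>}"
    then obtain \<beta> \<gamma> where "\<beta> > 0" "\<gamma> > 0" "right_series A \<beta> = {\<zero>\<^bsub>A\<^esub>}" "left_series A \<gamma> = {\<zero>\<^bsub>A\<^esub>}"
      by blast
    \<comment> \<open>Taking \<open>k = \<beta>\<close> puts some bracket term inside the zero
      subgroup; \<open>zero\<close> gives the reverse inclusion.\<close>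
    then show "\<exists>\<alpha>>0. bracket_series A \<alpha> = {\<zero>\<^bsub>A\<^esub>}"
      using bracket_series_subset_right_series[of \<gamma> \<beta>] zero by blast
  qed
qed

end
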